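(* For every positive integer $n$ the sequence $(m_{n,k})_{1\le k\le n}$ is log-concave.
   Context: A finite sequence of positive real numbers $(a_k)$ is log-concave if $a_{k-1}a_{k+1}\le a_k^2$ for all indices $k$ such that $k-1$, $k$, $k+1$ are all in the index range. $m_{n,k}$ is the number of permutations of $\{1,\dots,n\}$ whose longest increasing subsequence has length $k$ and whose longest decreasing subsequence has length $n-k+1$ (equivalently, those permutations with longest increasing subsequence of length $k$ which are the merge of an increasing and a decreasing subsequence having one point in common). *)

theory Defs
  imports Complex_Main "HOL-Combinatorics.Permutations"
begin

text \<open>The finite sequence \<open>a l, \<dots>, a u\<close>; for \<open>k\<close> strictly between \<open>l\<close> and \<open>u\<close> the
  subtraction \<open>k - 1\<close> does not truncate.\<close>

definition log_concave_seq :: "nat \<Rightarrow> nat \<Rightarrow> (nat \<Rightarrow> real) \<Rightarrow> bool" where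
  "log_concave_seq l u a \<longleftrightarrow>
     (\<forall>k\<in>{l..u}. 0 < a k) \<and> (\<forall>k\<in>{l<..<u}. a (k - 1) * a (k + 1) \<le> (a k)\<^sup>2)"

text \<open>A subsequence of the word \<open>p 1, \<dots>, p n\<close> is given by its set \<open>S\<close> of positions.\<close>

definition longest_inc :: "nat \<Rightarrow> (nat \<Rightarrow> nat) \<Rightarrow> nat" where
  "longest_inc n p = Max {card S | S. S \<subseteq> {1..n} \<and> strict_mono_on S p}"

definition longest_dec :: "nat \<Rightarrow> (nat \<Rightarrow> nat) \<Rightarrow> nat" where
  "longest_dec n p = Max {card S | S. S \<subseteq> {1..n} \<and> strict_antimono_on S p}"

definition m_count :: "nat \<Rightarrow> nat \<Rightarrow> nat" where
  "m_count n k = card {p. p permutes {1..n} \<and> longest_inc n p = k \<and> longest_dec n p = n - k + 1}"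

end

theory Submission
  imports Defs "HOL-Library.Infinite_Set"
begin

text \<open>
  The counts have a closed form: \<open>m_count n k = (n - 1 choose (k - 1))\<^sup>2\<close>. Binomial coefficients
  are positive and log-concave, and both properties survive squaring. Behind the formula is the
  Robinson--Schensted correspondence, under which these permutations are those of hook shape
  and a tableau of hook shape is determined by its descent set. The proof below is a direct
  bijection: it sends a permutation \<open>p\<close> to the pair of the ascent sets of \<open>p\<close> and of its inverse,
  and the claim is that this hits every pair of \<open>(k - 1)\<close>-element subsets of \<open>{1..<n}\<close> exactly once.

  An increasing subsequence of length \<open>k\<close> and a decreasing one of length \<open>n - k + 1\<close> share at
  most one point, so here they share exactly one point \<open>i\<close>, a centre, and together they exhaust the
  permutation. In the plot of \<open>p\<close> the point \<open>(i, p i)\<close> then cuts out four quadrants; the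
  increasing sequence fills the lower left and upper right one, the decreasing sequence the other
  two (\<open>longest_iff_center\<close>). Write I or D over each position other than \<open>i\<close>, according to the
  subsequence it belongs to. After removal of \<open>i\<close> and renumbering, the positions with letter I form the ascent set of
  \<open>p\<close> (\<open>rising_eq_insert_gap\<close>), and the same holds for values and the inverse. So the two sets, the
  centre and its value determine \<open>p\<close> (\<open>permutation_unique_of_center\<close>).

  A centre need not be unique, and not every \<open>i\<close> is possible. Both points are settled by
  lattice paths in a rectangle of width \<open>k - 1\<close> and height \<open>n - k\<close>. Reading the first set, with a
  step east for a member and a step north for a non-member, gives a path from the south-west to
  the north-east corner; reading the second, with a step south for a non-member, gives a path from
  the north-west to the south-east corner. A centre is a common point of the two paths: the
  letters before it on either path count the points in the quadrants. Two such paths always meet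
  (\<open>ex_gap_zero\<close>), which yields surjectivity. Their common points form one straight run, along which
  a centre can be moved one step at a time (\<open>center_step\<close>); so two permutations with the same pair
  of ascent sets have a centre in common, which yields injectivity (\<open>ascents_inject\<close>).
\<close>

section \<open>Monotone functions between finite sets\<close>

lemma rank_inject:
  fixes x y :: "'a::linorder"
  assumes "finite V" "x \<in> V" "y \<in> V"
    and "card {z\<in>V. z < x} = card {z\<in>V. z < y}"
  shows "x = y"
proof -
  have lt: "card {z\<in>V. z < a} < card {z\<in>V. z < b}" if "a < b" "a \<in> V" for a b
    by (rule psubset_card_mono) (use assms(1) that in auto)
  show ?thesis
    using lt[of x y] lt[of y x] assms by (cases x y rule: linorder_cases) auto
qed

lemma rank_strict_mono_on:
  fixes f :: "'a::linorder \<Rightarrow> 'b::linorder"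
  assumes "strict_mono_on S f" "x \<in> S"
  shows "card {z \<in> f ` S. z < f x} = card {y\<in>S. y < x}"
proof -
  have "{z \<in> f ` S. z < f x} = f ` {y\<in>S. y < x}"
    using assms by (auto simp: strict_mono_on_less)
  moreover have "inj_on f {y\<in>S. y < x}"
    using strict_mono_on_imp_inj_on[OF assms(1)] by (rule inj_on_subset) auto
  ultimately show ?thesis
    by (simp add: card_image)
qed

lemma rank_strict_antimono_on:
  fixes f :: "'a::linorder \<Rightarrow> 'b::linorder"
  assumes "strict_antimono_on S f" "x \<in> S"
  shows "card {z \<in> f ` S. z < f x} = card {y\<in>S. x < y}"
proof -
  have less: "f y < f x" if "x < y" "y \<in> S" "x \<in> S" for x y
    using monotone_onD[OF assms(1) that(3,2,1)] .
  have "x < y" if "f y < f x" "y \<in> S" for y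
    using that less[of y x] assms(2) by (cases x y rule: linorder_cases) auto
  then have "{z \<in> f ` S. z < f x} = f ` {y\<in>S. x < y}"
    using less assms(2) by auto
  moreover have "inj_on f {y\<in>S. x < y}"
  proof (rule inj_onI)
    fix a b assume "a \<in> {y\<in>S. x < y}" "b \<in> {y\<in>S. x < y}" "f a = f b"
    then show "a = b"
      using less[of a b] less[of b a] by (cases a b rule: linorder_cases) auto
  qed
  ultimately show ?thesis
    by (simp add: card_image)
qed

lemma strict_mono_on_unique:
  fixes f g :: "'a::linorder \<Rightarrow> 'b::linorder"
  assumes "finite S" "strict_mono_on S f" "strict_mono_on S g" "f ` S = g ` S" "x \<in> S"
  shows "f x = g x"
proof (rule rank_inject)
  show "finite (f ` S)" "f x \<in> f ` S" "g x \<in> f ` S"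
    using assms by auto
  show "card {z \<in> f ` S. z < f x} = card {z \<in> f ` S. z < g x}"
    using rank_strict_mono_on[OF assms(2,5)] rank_strict_mono_on[OF assms(3,5)] assms(4) by simp
qed

lemma strict_antimono_on_neg:
  fixes f :: "nat \<Rightarrow> nat"
  shows "strict_antimono_on S f \<longleftrightarrow> strict_mono_on S (\<lambda>x. - int (f x))"
  by (simp add: monotone_on_def)

lemma strict_antimono_on_unique:
  fixes f g :: "nat \<Rightarrow> nat"
  assumes "finite S" "strict_antimono_on S f" "strict_antimono_on S g" "f ` S = g ` S" "x \<in> S"
  shows "f x = g x"
proof -
  have "(\<lambda>x. - int (f x)) ` S = (\<lambda>x. - int (g x)) ` S"
    using arg_cong[OF assms(4), of "image (\<lambda>y. - int y)"] by (simp only: image_image)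
  then have "- int (f x) = - int (g x)"
    using assms by (intro strict_mono_on_unique[of S "\<lambda>x. - int (f x)" "\<lambda>x. - int (g x)" x])
      (simp_all add: strict_antimono_on_neg)
  then show ?thesis by simp
qed

lemma ex_strict_mono_on:
  fixes S T :: "nat set"
  assumes "finite S" "finite T" "card S = card T"
  shows "\<exists>f. strict_mono_on S f \<and> f ` S = T"
proof -
  obtain a where a: "bij_betw a {..<card S} S" "strict_mono_on {..<card S} a"
    using ex_bij_betw_strict_mono_card[OF assms(1)] by blast
  obtain b where b: "bij_betw b {..<card T} T" "strict_mono_on {..<card T} b"
    using ex_bij_betw_strict_mono_card[OF assms(2)] by blast
  define c where "c = the_inv_into {..<card S} a"
  have ca: "c (a x) = x" if "x < card S" for x
    using a(1) that unfolding c_def by (auto simp: bij_betw_def intro!: the_inv_into_f_f)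
  have S: "S = a ` {..<card S}" and T: "T = b ` {..<card S}"
    using a(1) b(1) assms(3) by (auto simp: bij_betw_def)
  have "(b \<circ> c) ` S = T"
    by (subst S, subst T) (auto simp: ca image_image)
  moreover have "strict_mono_on S (b \<circ> c)"
  proof (rule monotone_onI)
    fix x y assume "x \<in> S" "y \<in> S" and less: "x < y"
    then obtain u v where uv: "u < card S" "v < card S" "x = a u" "y = a v"
      using S by (metis imageE lessThan_iff)
    then have "u < v"
      using less a(2) by (simp add: strict_mono_on_less)
    then show "(b \<circ> c) x < (b \<circ> c) y"
      using uv ca b(2) assms(3) by (simp add: strict_mono_on_less)
  qed
  ultimately show ?thesis by blast
qed

lemma ex_strict_antimono_on:
  fixes S T :: "nat set"
  assumes "finite S" "finite T" "card S = card T"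
  shows "\<exists>f. strict_antimono_on S f \<and> f ` S = T"
proof -
  obtain m where m: "\<And>y. y \<in> T \<Longrightarrow> y \<le> m"
    using assms(2) finite_nat_set_iff_bounded_le by auto
  have inj: "inj_on (\<lambda>y. m - y) T"
    using m by (auto simp: inj_on_def) (metis diff_diff_cancel)
  obtain f where f: "strict_mono_on S f" "f ` S = (\<lambda>y. m - y) ` T"
    using ex_strict_mono_on[of S "(\<lambda>y. m - y) ` T"] assms card_image[OF inj] by auto
  have "(\<lambda>x. m - f x) ` S = (\<lambda>z. m - z) ` (\<lambda>y. m - y) ` T"
    by (simp add: f(2)[symmetric] image_image)
  also have "\<dots> = T"
    using m by (force simp: image_image)
  finally have "(\<lambda>x. m - f x) ` S = T" .
  moreover have "strict_antimono_on S (\<lambda>x. m - f x)"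
  proof (rule monotone_onI)
    fix x y assume xy: "x \<in> S" "y \<in> S" "x < y"
    have "f y \<le> m"
      using f(2) xy(2) by (metis diff_le_self imageE image_eqI)
    moreover have "f x < f y"
      using f(1) xy by (simp add: strict_mono_on_less)
    ultimately show "m - f x > m - f y" by simp
  qed
  ultimately show ?thesis by blast
qed

section \<open>Centres\<close>

text \<open>The closed lower left and upper right quadrants around the point \<open>(i, p i)\<close> of the plot of \<open>p\<close>;
  at \<open>j = i\<close> both sides of the equivalence are false, so \<open>i\<close> itself is included.\<close>

definition rising :: "nat \<Rightarrow> (nat \<Rightarrow> nat) \<Rightarrow> nat \<Rightarrow> nat set" where
  "rising n p i = {j\<in>{1..n}. j < i \<longleftrightarrow> p j < p i}"

text \<open>The closed upper left and lower right quadrants, again with \<open>i\<close> included.\<close>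

definition falling :: "nat \<Rightarrow> (nat \<Rightarrow> nat) \<Rightarrow> nat \<Rightarrow> nat set" where
  "falling n p i = {j\<in>{1..n}. j \<le> i \<longleftrightarrow> p i \<le> p j}"

definition center :: "nat \<Rightarrow> (nat \<Rightarrow> nat) \<Rightarrow> nat \<Rightarrow> bool" where
  "center n p i \<longleftrightarrow>
     i \<in> {1..n} \<and> strict_mono_on (rising n p i) p \<and> strict_antimono_on (falling n p i) p"

definition ascents :: "nat \<Rightarrow> (nat \<Rightarrow> nat) \<Rightarrow> nat set" where
  "ascents n p = {j\<in>{1..<n}. p j < p (Suc j)}"

text \<open>An increasing and a decreasing sequence with one common point must occupy the quadrants around
  it: a point of the first lies on the same side of \<open>i\<close> horizontally and vertically, a point of the
  second on opposite sides.\<close>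

lemma center_of_cover:
  assumes "strict_mono_on S p" "strict_antimono_on T p" "S \<union> T = {1..n}" "S \<inter> T = {i}"
  shows "center n p i" "rising n p i = S" "falling n p i = T"
proof -
  have i: "i \<in> S" "i \<in> T" using assms by auto
  have S: "j < i \<longleftrightarrow> p j < p i" if "j \<in> S" for j
    using i(1) that by (simp add: strict_mono_on_less[OF assms(1)])
  have T: "j < i \<longleftrightarrow> p i < p j" "j > i \<longleftrightarrow> p i > p j" if "j \<in> T" for j
  proof -
    have "j < i \<longrightarrow> p i < p j" "i < j \<longrightarrow> p j < p i"
      using monotone_onD[OF assms(2) that i(2)] monotone_onD[OF assms(2) i(2) that] by blast+
    then show "j < i \<longleftrightarrow> p i < p j" "j > i \<longleftrightarrow> p i > p j"
      by (cases j i rule: linorder_cases; force)+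
  qed
  have split: "j \<in> S \<or> j \<in> T \<and> j \<noteq> i" if "j \<in> {1..n}" for j
    using that i unfolding assms(3)[symmetric] by blast
  show r: "rising n p i = S"
  proof (intro set_eqI iffI)
    fix j assume "j \<in> rising n p i"
    then show "j \<in> S"
      using split[of j] T[of j] unfolding rising_def by (auto simp: not_less)
  next
    fix j assume "j \<in> S"
    then show "j \<in> rising n p i"
      using S[of j] unfolding rising_def assms(3)[symmetric] by blast
  qed
  have split2: "j \<in> T \<or> j \<in> S \<and> j \<noteq> i" if "j \<in> {1..n}" for j
    using that i unfolding assms(3)[symmetric] by blast
  have S': "i < j \<longleftrightarrow> p i < p j" if "j \<in> S" for j
    using i(1) that by (simp add: strict_mono_on_less[OF assms(1)])
  show f: "falling n p i = T"
  proof (intro set_eqI iffI)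
    fix j assume "j \<in> falling n p i"
    then show "j \<in> T"
      using split2[of j] S[of j] S'[of j] unfolding falling_def
      by (cases j i rule: linorder_cases) auto
  next
    fix j assume "j \<in> T"
    then show "j \<in> falling n p i"
      using T[of j] assms(3) unfolding falling_def
      by (cases j i rule: linorder_cases) auto
  qed
  show "center n p i"
    unfolding center_def r f using assms by auto
qed

lemma falling_eq:
  assumes "inj_on p {1..n}" "i \<in> {1..n}"
  shows "falling n p i = insert i ({1..n} - rising n p i)"
proof (rule set_eqI)
  fix j
  show "j \<in> falling n p i \<longleftrightarrow> j \<in> insert i ({1..n} - rising n p i)"
    using assms inj_onD[OF assms(1), of j i] unfolding falling_def rising_def
    by (cases j i rule: linorder_cases) (auto simp: not_less)
qed

lemma rising_Int_falling:
  assumes "inj_on p {1..n}" "i \<in> {1..n}"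
  shows "rising n p i \<inter> falling n p i = {i}"
  using assms by (auto simp: falling_eq) (auto simp: rising_def)

lemma rising_Un_falling:
  assumes "inj_on p {1..n}" "i \<in> {1..n}"
  shows "rising n p i \<union> falling n p i = {1..n}"
  using assms by (auto simp: falling_eq) (auto simp: rising_def)

lemma card_rising_plus_card_falling:
  assumes "inj_on p {1..n}" "i \<in> {1..n}"
  shows "card (rising n p i) + card (falling n p i) = n + 1"
proof -
  have "finite (rising n p i)" "finite (falling n p i)"
    by (auto simp: rising_def falling_def)
  then show ?thesis
    using card_Un_Int[of "rising n p i" "falling n p i"] rising_Int_falling[OF assms]
      rising_Un_falling[OF assms] by simp
qed

lemma card_mono_Int_antimono:
  fixes p :: "nat \<Rightarrow> nat"
  assumes "strict_mono_on S p" "strict_antimono_on T p" "finite S"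
  shows "card (S \<inter> T) \<le> 1"
proof -
  have "x = y" if "x \<in> S \<inter> T" "y \<in> S \<inter> T" for x y
  proof (rule ccontr)
    have no: False if "a \<in> S \<inter> T" "b \<in> S \<inter> T" "a < b" for a b
      using monotone_onD[OF assms(1), of a b] monotone_onD[OF assms(2), of a b] that by auto
    assume "x \<noteq> y"
    then show False using no that by (meson linorder_neqE)
  qed
  then show ?thesis
    using assms(3) card_le_Suc0_iff_eq[of "S \<inter> T"] by auto
qed

section \<open>Longest monotone subsequences and centres\<close>

lemma longest_inc_witness:
  "\<exists>S\<subseteq>{1..n}. strict_mono_on S p \<and> card S = longest_inc n p"
proof -
  let ?X = "{card S | S. S \<subseteq> {1..n} \<and> strict_mono_on S p}"
  have "finite ?X"
    by (rule finite_subset[of _ "card ` Pow {1..n}"]) auto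
  moreover have "0 \<in> ?X"
    by (auto intro!: exI[of _ "{}"])
  ultimately have "Max ?X \<in> ?X"
    by (intro Max_in) auto
  then show ?thesis unfolding longest_inc_def by auto
qed

lemma longest_inc_ge:
  assumes "S \<subseteq> {1..n}" "strict_mono_on S p"
  shows "card S \<le> longest_inc n p"
  unfolding longest_inc_def
proof (rule Max_ge)
  show "finite {card S | S. S \<subseteq> {1..n} \<and> strict_mono_on S p}"
    by (rule finite_subset[of _ "card ` Pow {1..n}"]) auto
qed (use assms in blast)

lemma longest_dec_witness:
  "\<exists>S\<subseteq>{1..n}. strict_antimono_on S p \<and> card S = longest_dec n p"
proof -
  let ?X = "{card S | S. S \<subseteq> {1..n} \<and> strict_antimono_on S p}"
  have "finite ?X"
    by (rule finite_subset[of _ "card ` Pow {1..n}"]) auto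
  moreover have "0 \<in> ?X"
    by (auto intro!: exI[of _ "{}"])
  ultimately have "Max ?X \<in> ?X"
    by (intro Max_in) auto
  then show ?thesis unfolding longest_dec_def by auto
qed

lemma longest_dec_ge:
  assumes "S \<subseteq> {1..n}" "strict_antimono_on S p"
  shows "card S \<le> longest_dec n p"
  unfolding longest_dec_def
proof (rule Max_ge)
  show "finite {card S | S. S \<subseteq> {1..n} \<and> strict_antimono_on S p}"
    by (rule finite_subset[of _ "card ` Pow {1..n}"]) auto
qed (use assms in blast)

text \<open>Since an increasing and a decreasing subsequence share at most one point, their lengths add up
  to at most \<open>n + 1\<close>. Lengths \<open>k\<close> and \<open>n - k + 1\<close> reach this bound, which forces a covering with one
  common point. Conversely, by the same bound the two sequences through a centre are both of
  maximal length.\<close>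

lemma longest_iff_center:
  assumes p: "inj_on p {1..n}" and k: "k \<in> {1..n}"
  shows "longest_inc n p = k \<and> longest_dec n p = n - k + 1 \<longleftrightarrow>
         (\<exists>i. center n p i \<and> card (rising n p i) = k)"
proof
  assume L: "longest_inc n p = k \<and> longest_dec n p = n - k + 1"
  obtain S where S: "S \<subseteq> {1..n}" "strict_mono_on S p" "card S = k"
    using longest_inc_witness L by metis
  obtain T where T: "T \<subseteq> {1..n}" "strict_antimono_on T p" "card T = n - k + 1"
    using longest_dec_witness L by metis
  have fin: "finite S" "finite T"
    using S(1) T(1) finite_subset by blast+
  have "card (S \<union> T) + card (S \<inter> T) = n + 1"
    using card_Un_Int[OF fin] S(3) T(3) k by auto
  moreover have "card (S \<union> T) \<le> n"
    using S(1) T(1) card_mono[of "{1..n}" "S \<union> T"] by auto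
  moreover have "card (S \<inter> T) \<le> 1"
    using S(2) T(2) fin(1) by (rule card_mono_Int_antimono)
  ultimately have "card (S \<inter> T) = 1" and "card (S \<union> T) = card {1..n}"
    by auto
  then obtain i where i: "S \<inter> T = {i}" and "S \<union> T = {1..n}"
    using S(1) T(1) card_subset_eq[of "{1..n}" "S \<union> T"] by (auto simp: card_1_singleton_iff)
  then show "\<exists>i. center n p i \<and> card (rising n p i) = k"
    using center_of_cover[OF S(2) T(2)] S(3) by blast
next
  assume "\<exists>i. center n p i \<and> card (rising n p i) = k"
  then obtain i where i: "i \<in> {1..n}" "strict_mono_on (rising n p i) p"
      "strict_antimono_on (falling n p i) p" and ck: "card (rising n p i) = k"
    unfolding center_def by blast
  have sub: "rising n p i \<subseteq> {1..n}" "falling n p i \<subseteq> {1..n}"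
    by (auto simp: rising_def falling_def)
  have cf: "card (falling n p i) = n - k + 1"
    using card_rising_plus_card_falling[OF p i(1)] ck k by auto
  have bound: "card S + card T \<le> n + 1"
    if "S \<subseteq> {1..n}" "T \<subseteq> {1..n}" "strict_mono_on S p" "strict_antimono_on T p" for S T
  proof -
    have fin: "finite S" "finite T"
      using that finite_subset by blast+
    show ?thesis
      using card_Un_Int[OF fin] card_mono_Int_antimono[OF that(3,4) fin(1)]
        card_mono[of "{1..n}" "S \<union> T"] that(1,2) by auto
  qed
  obtain S where S: "S \<subseteq> {1..n}" "strict_mono_on S p" "card S = longest_inc n p"
    using longest_inc_witness by metis
  obtain T where T: "T \<subseteq> {1..n}" "strict_antimono_on T p" "card T = longest_dec n p"
    using longest_dec_witness by metis
  show "longest_inc n p = k \<and> longest_dec n p = n - k + 1"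
    using bound[OF S(1) sub(2) S(2) i(3)] bound[OF sub(1) T(1) i(2) T(2)]
      longest_inc_ge[OF sub(1) i(2)] longest_dec_ge[OF sub(2) i(3)] S(3) T(3) cf ck k by auto
qed

section \<open>Ascents of a permutation with a centre\<close>

text \<open>The order isomorphism from the natural numbers onto those different from \<open>i\<close>.\<close>

definition skip :: "nat \<Rightarrow> nat \<Rightarrow> nat" where
  "skip i j = (if j < i then j else Suc j)"

definition insert_gap :: "nat \<Rightarrow> nat set \<Rightarrow> nat set" where
  "insert_gap i A = insert i (skip i ` A)"

lemma inj_skip: "inj (skip i)"
  by (auto simp: inj_def skip_def split: if_splits)

lemma skip_neq: "skip i j \<noteq> i" "i \<noteq> skip i j"
  by (auto simp: skip_def)

lemma insert_gap_inject: "insert_gap i A = insert_gap i B \<longleftrightarrow> A = B"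
proof
  assume "insert_gap i A = insert_gap i B"
  then have "skip i ` A = skip i ` B"
    unfolding insert_gap_def by (subst (asm) insert_ident) (auto simp: skip_neq)
  then show "A = B" by (simp add: inj_image_eq_iff inj_skip)
qed simp

lemma card_insert_gap: "finite A \<Longrightarrow> card (insert_gap i A) = Suc (card A)"
  unfolding insert_gap_def
  by (subst card_insert_disjoint) (auto simp: skip_neq card_image inj_on_subset[OF inj_skip])

lemma insert_gap_less: "{j \<in> insert_gap i A. j < i} = {j \<in> A. j < i}"
  by (auto simp: insert_gap_def skip_def)

lemma insert_gap_subset:
  "A \<subseteq> {1..<n} \<Longrightarrow> i \<in> {1..n} \<Longrightarrow> insert_gap i A \<subseteq> {1..n}"
  by (auto simp: insert_gap_def skip_def)

text \<open>Let \<open>j\<close> lie to the left of the centre. If it is on the increasing sequence, its right neighbour is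
  either the next point of that sequence or at least as high as the centre: an ascent. If it is
  on the decreasing sequence, the right neighbour is likewise lower: a descent. To the right of the
  centre, the same argument describes the step from \<open>j\<close> to \<open>Suc j\<close> by the type of \<open>Suc j\<close>; hence the
  shift by one beyond \<open>i\<close>.\<close>

lemma rising_eq_insert_gap:
  assumes p: "inj_on p {1..n}" and c: "center n p i"
  shows "rising n p i = insert_gap i (ascents n p)"
proof -
  have i: "i \<in> {1..n}" and I: "strict_mono_on (rising n p i) p"
    and D: "strict_antimono_on (falling n p i) p"
    using c unfolding center_def by auto
  have dich: "j \<in> falling n p i" if "j \<in> {1..n}" "j \<notin> rising n p i" for j
    using that falling_eq[OF p i] by auto
  have neq: "p a \<noteq> p b" if "a \<in> {1..n}" "b \<in> {1..n}" "a \<noteq> b" for a b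
    using p that by (auto dest: inj_onD)
  have left: "j \<in> rising n p i \<longleftrightarrow> p j < p (Suc j)" if j: "1 \<le> j" "j < i" for j
  proof -
    have J: "j \<in> {1..n}" "Suc j \<in> {1..n}" using j i by auto
    show ?thesis
    proof (cases "j \<in> rising n p i")
      case True
      then have "p j < p i" using j by (simp add: rising_def)
      moreover have "p j < p (Suc j)" if "Suc j \<in> rising n p i"
        using I True that by (simp add: strict_mono_on_less)
      moreover have "p i \<le> p (Suc j)" if "Suc j \<notin> rising n p i"
        using dich[OF J(2) that] j by (simp add: falling_def)
      ultimately show ?thesis using True by fastforce
    next
      case False
      then have "p i < p j" using j J neq[OF J(1) i] by (auto simp: rising_def)
      moreover have "p (Suc j) < p j" if "Suc j \<in> falling n p i"
        using monotone_onD[OF D dich[OF J(1) False] that] by simp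
      moreover have "p (Suc j) \<le> p i" if "Suc j \<notin> falling n p i"
        using that j J by (auto simp: falling_def)
      ultimately show ?thesis using False by fastforce
    qed
  qed
  have right: "Suc j \<in> rising n p i \<longleftrightarrow> p j < p (Suc j)" if j: "i \<le> j" "j < n" for j
  proof -
    have J: "j \<in> {1..n}" "Suc j \<in> {1..n}" using j i by auto
    show ?thesis
    proof (cases "Suc j \<in> rising n p i")
      case True
      then have "p i < p (Suc j)" using j J neq[OF J(2) i] by (auto simp: rising_def)
      moreover have "p j < p (Suc j)" if "j \<in> rising n p i"
        using I True that by (simp add: strict_mono_on_less)
      moreover have "p j \<le> p i" if "j \<notin> rising n p i"
        using dich[OF J(1) that] j by (cases "i = j") (auto simp: falling_def)
      ultimately show ?thesis using True by fastforce
    next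
      case False
      then have "p (Suc j) < p i" using j J by (auto simp: rising_def)
      moreover have "p (Suc j) < p j" if "j \<in> falling n p i"
        using monotone_onD[OF D that dich[OF J(2) False]] by simp
      moreover have "p i \<le> p j" if "j \<notin> falling n p i"
        using that j J by (auto simp: falling_def)
      ultimately show ?thesis using False by fastforce
    qed
  qed
  show ?thesis
  proof (rule set_eqI)
    fix j
    show "j \<in> rising n p i \<longleftrightarrow> j \<in> insert_gap i (ascents n p)"
    proof (cases j i rule: linorder_cases)
      case less
      then show ?thesis
        using left[of j] i by (auto simp: insert_gap_def skip_def ascents_def rising_def)
    next
      case equal
      then show ?thesis using i by (simp add: insert_gap_def rising_def)
    next
      case greater
      then obtain m where m: "j = Suc m" "i \<le> m" by (cases j) auto
      have "j \<in> insert_gap i (ascents n p) \<longleftrightarrow> m \<in> ascents n p"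
        using m by (auto simp: insert_gap_def skip_def)
      also have "\<dots> \<longleftrightarrow> m < n \<and> Suc m \<in> rising n p i"
        using right[of m] m i by (auto simp: ascents_def)
      finally show ?thesis using m by (auto simp: rising_def)
    qed
  qed
qed

lemma center_inv:
  assumes p: "p permutes {1..n}" and c: "center n p i"
  shows "center n (inv p) (p i)" "rising n (inv p) (p i) = p ` rising n p i"
    "falling n (inv p) (p i) = p ` falling n p i"
proof -
  have i: "i \<in> {1..n}" and I: "strict_mono_on (rising n p i) p"
    and D: "strict_antimono_on (falling n p i) p"
    using c unfolding center_def by auto
  have inj: "inj_on p {1..n}"
    using p by (rule permutes_inj_on)
  have mono: "strict_mono_on (p ` rising n p i) (inv p)"
  proof (rule monotone_onI, elim imageE)
    fix x y u v assume "x = p u" "y = p v" "u \<in> rising n p i" "v \<in> rising n p i" "x < y"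
    then show "inv p x < inv p y"
      using I by (simp add: strict_mono_on_less permutes_inverses[OF p])
  qed
  have antimono: "strict_antimono_on (p ` falling n p i) (inv p)"
  proof (rule monotone_onI, elim imageE)
    fix x y u v assume xy: "x = p u" "y = p v" "u \<in> falling n p i" "v \<in> falling n p i" "x < y"
    then have "v < u"
      using monotone_onD[OF D, of u v] by (cases u v rule: linorder_cases) auto
    then show "inv p x > inv p y"
      using xy by (simp add: permutes_inverses[OF p])
  qed
  have un: "p ` rising n p i \<union> p ` falling n p i = {1..n}"
    unfolding image_Un[symmetric] rising_Un_falling[OF inj i] by (rule permutes_image[OF p])
  have int: "p ` rising n p i \<inter> p ` falling n p i = {p i}"
    unfolding image_Int[OF permutes_inj[OF p], symmetric] rising_Int_falling[OF inj i] by simp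
  show "center n (inv p) (p i)" "rising n (inv p) (p i) = p ` rising n p i"
    "falling n (inv p) (p i) = p ` falling n p i"
    using center_of_cover[OF mono antimono un int] by blast+
qed

text \<open>The ascent sets and the centre fix the positions and the values of both monotone sequences,
  and a monotone function on a finite set is determined by its image.\<close>

lemma permutation_unique_of_center:
  assumes p: "p permutes {1..n}" and q: "q permutes {1..n}"
    and c: "center n p i" "center n q i" and pq: "p i = q i"
    and asc: "ascents n p = ascents n q" "ascents n (inv p) = ascents n (inv q)"
  shows "p = q"
proof
  fix j
  have i: "i \<in> {1..n}" using c unfolding center_def by simp
  have inj: "inj_on p {1..n}" "inj_on q {1..n}"
    "inj_on (inv p) {1..n}" "inj_on (inv q) {1..n}"
    using p q permutes_inv[of _ "{1..n}"] by (auto intro: permutes_inj_on)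
  have I: "rising n p i = rising n q i"
    using rising_eq_insert_gap inj c asc by metis
  then have D: "falling n p i = falling n q i"
    using falling_eq inj i by metis
  have V: "p ` rising n p i = q ` rising n q i"
    using center_inv(1,2)[OF p c(1)] center_inv(1,2)[OF q c(2)] inj asc pq rising_eq_insert_gap
    by metis
  have "p i \<in> {1..n}"
    using permutes_in_image[OF p] i by blast
  then have W: "p ` falling n p i = q ` falling n q i"
    using center_inv(2,3)[OF p c(1)] center_inv(2,3)[OF q c(2)] falling_eq inj V pq by metis
  have fin: "finite (rising n p i)" "finite (falling n p i)"
    by (auto simp: rising_def falling_def)
  have "p j = q j" if "j \<in> rising n p i"
    using c fin I V that unfolding center_def by (intro strict_mono_on_unique[of "rising n p i"]) auto
  moreover have "p j = q j" if "j \<in> falling n p i"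
    using c fin D W that unfolding center_def
    by (intro strict_antimono_on_unique[of "falling n p i"]) auto
  moreover have "p j = q j" if "j \<notin> {1..n}"
    using that p q by (simp add: permutes_def)
  ultimately show "p j = q j"
    using rising_Un_falling[OF inj(1) i] by blast
qed

section \<open>Crossing lattice paths\<close>

definition members_upto :: "nat set \<Rightarrow> nat \<Rightarrow> nat" where
  "members_upto A t = card (A \<inter> {1..t})"

text \<open>After \<open>t\<close> steps the north-east path of \<open>A\<close> is at the point \<open>(x, y)\<close> with \<open>x = members_upto A t\<close> and
  \<open>y = t - x\<close>. A path that goes east or south from the north-west corner \<open>(0, r)\<close> needs
  \<open>x + (r - y) = 2 * x + r - t\<close> steps to get there. In the range of interest \<open>y \<le> r\<close>, so that the
  subtraction does not truncate (lemma \<open>members_upto_complement_le\<close>).\<close>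

definition level :: "nat \<Rightarrow> nat set \<Rightarrow> nat \<Rightarrow> nat" where
  "level r A t = 2 * members_upto A t + r - t"

lemma members_upto_Suc: "members_upto A (Suc t) = members_upto A t + (if Suc t \<in> A then 1 else 0)"
proof -
  have "A \<inter> {1..Suc t} = (if Suc t \<in> A then insert (Suc t) (A \<inter> {1..t}) else A \<inter> {1..t})"
    by (auto simp: le_Suc_eq)
  then show ?thesis unfolding members_upto_def by simp
qed

lemma members_upto_le: "members_upto A t \<le> t"
  unfolding members_upto_def using card_mono[of "{1..t}" "A \<inter> {1..t}"] by simp

lemma members_upto_le_card: "finite A \<Longrightarrow> members_upto A t \<le> card A"
  unfolding members_upto_def by (rule card_mono) auto

lemma card_less_eq_members_upto: "A \<subseteq> {1..<n} \<Longrightarrow> 1 \<le> i \<Longrightarrow> card {j \<in> A. j < i} = members_upto A (i - 1)"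
  unfolding members_upto_def by (rule arg_cong[where f = card]) (auto simp: subset_iff)

lemma members_upto_complement_le:
  assumes "A \<subseteq> {1..<n}" "card A + r + 1 = n" "t < n"
  shows "t \<le> members_upto A t + r"
proof -
  have fin: "finite A" using assms(1) finite_subset by blast
  have "card ({1..t} - A) = t - members_upto A t"
    unfolding members_upto_def by (subst card_Diff_subset_Int) (auto simp: Int_commute fin)
  moreover have "card ({1..t} - A) \<le> card ({1..<n} - A)"
    using assms(3) by (intro card_mono) auto
  moreover have "card ({1..<n} - A) = n - 1 - card A"
    using assms(1) fin by (simp add: card_Diff_subset)
  ultimately show ?thesis using assms(2) by auto
qed

text \<open>Horizontal distance between the north-east path of \<open>A\<close> after \<open>t\<close> steps and the south-east path of
  \<open>B\<close>, measured along the diagonal on which the former lies; it vanishes iff the paths meet there.\<close>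

definition gap :: "nat \<Rightarrow> nat set \<Rightarrow> nat set \<Rightarrow> nat \<Rightarrow> int" where
  "gap r A B t = int (members_upto A t) - int (members_upto B (level r A t))"

text \<open>A step east on the first path advances the diagonal by one, and the second path moves east by at
  most one meanwhile. A step north goes back by one diagonal, and the second path is retraced by one
  step, which is west or north. Either way the distance grows by \<open>0\<close> or \<open>1\<close>.\<close>

lemma gap_Suc:
  assumes "A \<subseteq> {1..<n}" "card A + r + 1 = n" "Suc t < n"
  shows "gap r A B (Suc t) - gap r A B t \<in> {0, 1}"
proof -
  have bound: "t \<le> members_upto A t + r" "Suc t \<le> members_upto A (Suc t) + r"
    using members_upto_complement_le[OF assms(1,2)] assms(3) by auto
  show ?thesis
  proof (cases "Suc t \<in> A")
    case True
    then have "level r A (Suc t) = Suc (level r A t)"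
      using bound by (simp add: level_def members_upto_Suc)
    then show ?thesis using True by (simp add: gap_def members_upto_Suc)
  next
    case False
    then have "level r A t = Suc (level r A (Suc t))"
      using bound by (simp add: level_def members_upto_Suc)
    then show ?thesis using False by (simp add: gap_def members_upto_Suc)
  qed
qed

lemma gap_mono:
  assumes A: "A \<subseteq> {1..<n}" "card A + r + 1 = n" and "t \<le> u" "u < n"
  shows "gap r A B t \<le> gap r A B u"
  using \<open>t \<le> u\<close> \<open>u < n\<close>
proof (induction u rule: dec_induct)
  case (step m)
  then show ?case using gap_Suc[OF A step.prems, of B] by auto
qed simp

text \<open>Discrete intermediate value theorem: at the start the first path is on the west side of the
  rectangle, and at the end on its east side.\<close>

lemma ex_gap_zero:
  assumes A: "A \<subseteq> {1..<n}" "card A + r + 1 = n" and B: "B \<subseteq> {1..<n}" "card B = card A"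
  shows "\<exists>t<n. gap r A B t = 0"
proof -
  have fin: "finite B" using B(1) finite_subset by blast
  have "gap r A B 0 \<le> 0" by (simp add: gap_def members_upto_def)
  moreover have "0 \<le> gap r A B (n - 1)"
  proof -
    have "A \<inter> {1..n - 1} = A" using A(1) by (auto simp: subset_iff)
    then show ?thesis using members_upto_le_card[OF fin] B(2) by (simp add: gap_def members_upto_def)
  qed
  moreover have "\<bar>gap r A B (t + 1) - gap r A B t\<bar> \<le> 1" if "t < n - 1" for t
  proof -
    have "Suc t < n" using that by simp
    from gap_Suc[OF A this, of B] show ?thesis by auto
  qed
  ultimately obtain t where "t \<le> n - 1" "gap r A B t = 0"
    using nat0_intermed_int_val[of "n - 1" "gap r A B" 0] by blast
  then show ?thesis using A(2) by (intro exI[of _ t]) auto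
qed

section \<open>Centres are the common points of the paths\<close>

lemma card_complement_less:
  assumes "i \<in> {1..n}" "i \<in> I" "I \<subseteq> {1..n}"
  shows "card {j \<in> insert i ({1..n} - I). j < i} + card {j \<in> I. j < i} = i - 1"
proof -
  let ?L = "{j \<in> insert i ({1..n} - I). j < i}" and ?R = "{j \<in> I. j < i}"
  have un: "?L \<union> ?R = {1..<i}"
    using assms by (auto simp: subset_iff)
  have fin: "finite ?L" "finite ?R"
    using finite_subset[OF assms(3)] by simp_all
  have "?L \<inter> ?R = {}" by blast
  from card_Un_disjoint[OF fin this] show ?thesis
    unfolding un by simp
qed

lemma card_less_greater:
  fixes i :: "'a::linorder"
  assumes "finite D" "i \<in> D"
  shows "card D = card {j\<in>D. j < i} + 1 + card {j\<in>D. i < j}"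
proof -
  have "D = insert i ({j\<in>D. j < i} \<union> {j\<in>D. i < j})"
    using assms(2) by (auto simp: not_less)
  moreover have "card (insert i ({j\<in>D. j < i} \<union> {j\<in>D. i < j}))
      = Suc (card ({j\<in>D. j < i} \<union> {j\<in>D. i < j}))"
    by (rule card_insert_disjoint) (use assms(1) in auto)
  moreover have "card ({j\<in>D. j < i} \<union> {j\<in>D. i < j}) = card {j\<in>D. j < i} + card {j\<in>D. i < j}"
    by (rule card_Un_disjoint) (use assms(1) in auto)
  ultimately show ?thesis by simp
qed

lemma ascents_subset: "ascents n p \<subseteq> {1..<n}"
  by (auto simp: ascents_def)

lemma card_rising:
  assumes "inj_on p {1..n}" "center n p i"
  shows "card (rising n p i) = Suc (card (ascents n p))"
  using rising_eq_insert_gap[OF assms] finite_subset[OF ascents_subset] by (simp add: card_insert_gap)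

lemma card_rising_less:
  assumes "inj_on p {1..n}" "center n p i"
  shows "card {j \<in> rising n p i. j < i} = members_upto (ascents n p) (i - 1)"
proof -
  have "1 \<le> i" using assms(2) unfolding center_def by auto
  then show ?thesis
    unfolding rising_eq_insert_gap[OF assms] insert_gap_less
    by (rule card_less_eq_members_upto[OF ascents_subset])
qed

text \<open>The lower left quadrant contains as many positions as values, which are the members of the two
  ascent sets before \<open>i\<close> and before \<open>p i\<close>. The upper left and lower right quadrants together contain
  \<open>r\<close> points. The first count says that the paths have the same horizontal coordinate, the second
  that they are on the same diagonal.\<close>

lemma center_gap_zero:
  assumes p: "p permutes {1..n}" and c: "center n p i" and r: "card (ascents n p) + r + 1 = n"
  shows "gap r (ascents n p) (ascents n (inv p)) (i - 1) = 0"
    and "p i = Suc (level r (ascents n p) (i - 1))"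
proof -
  have i: "i \<in> {1..n}" and I: "strict_mono_on (rising n p i) p"
    and D: "strict_antimono_on (falling n p i) p"
    using c unfolding center_def by auto
  have v: "p i \<in> {1..n}"
    using permutes_in_image[OF p] i by blast
  have inj: "inj_on p {1..n}" "inj_on (inv p) {1..n}"
    using p permutes_inv[of _ "{1..n}"] by (auto intro: permutes_inj_on)
  note ci = center_inv[OF p c]
  have mem: "i \<in> rising n p i" "i \<in> falling n p i" "p i \<in> rising n (inv p) (p i)"
    using i v by (auto simp: rising_def falling_def)
  have sub: "rising n p i \<subseteq> {1..n}" "rising n (inv p) (p i) \<subseteq> {1..n}"
    by (auto simp: rising_def)
  have fin: "finite (falling n p i)" by (simp add: falling_def)
  have eq: "members_upto (ascents n p) (i - 1) = members_upto (ascents n (inv p)) (p i - 1)"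
    using rank_strict_mono_on[OF I mem(1)] card_rising_less[OF inj(1) c]
      card_rising_less[OF inj(2) ci(1)] ci(2) by simp
  have "card {j \<in> falling n p i. j < i} + members_upto (ascents n p) (i - 1) = i - 1"
    using card_complement_less[OF i mem(1) sub(1)] falling_eq[OF inj(1) i]
      card_rising_less[OF inj(1) c] by simp
  moreover have "card {w \<in> falling n (inv p) (p i). w < p i}
      + members_upto (ascents n (inv p)) (p i - 1) = p i - 1"
    using card_complement_less[OF v mem(3) sub(2)] falling_eq[OF inj(2) v]
      card_rising_less[OF inj(2) ci(1)] by simp
  moreover have "card {w \<in> falling n (inv p) (p i). w < p i} = card {j \<in> falling n p i. i < j}"
    unfolding ci(3) by (rule rank_strict_antimono_on[OF D mem(2)])
  moreover have "card (falling n p i) = r + 1"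
    using card_rising_plus_card_falling[OF inj(1) i] card_rising[OF inj(1) c] r by simp
  ultimately show level: "p i = Suc (level r (ascents n p) (i - 1))"
    using card_less_greater[OF fin mem(2)] eq v unfolding level_def by auto
  show "gap r (ascents n p) (ascents n (inv p)) (i - 1) = 0"
    using eq level by (simp add: gap_def)
qed

text \<open>If the paths also meet one step later, they share this step. When it goes east, position \<open>Suc i\<close> and
  value \<open>Suc (p i)\<close> both belong to the increasing sequence, directly after the centre in either order,
  so \<open>p (Suc i) = Suc (p i)\<close>. The two points are then adjacent in position and value, and the second can
  replace the first on the decreasing sequence. When the step goes north, exchange the roles of the
  two sequences: \<open>p i = Suc (p (Suc i))\<close>.\<close>

lemma center_step:
  assumes p: "p permutes {1..n}" and c: "center n p i" and r: "card (ascents n p) + r + 1 = n"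
    and "i < n" and gap: "gap r (ascents n p) (ascents n (inv p)) i = 0"
  shows "center n p (Suc i)"
proof -
  let ?A = "ascents n p" and ?B = "ascents n (inv p)"
  have cross: "members_upto ?A i = members_upto ?B (level r ?A i)"
    using gap by (simp add: gap_def)
  have i: "i \<in> {1..n}" and I: "strict_mono_on (rising n p i) p"
    and D: "strict_antimono_on (falling n p i) p"
    using c unfolding center_def by auto
  have v: "p i \<in> {1..n}"
    using permutes_in_image[OF p] i by blast
  have i': "Suc i \<in> {1..n}" using \<open>i < n\<close> by simp
  have inj: "inj_on p {1..n}"
    using p by (rule permutes_inj_on)
  note pinv = permutes_inverses[OF p]
  have eq: "p a = p b \<longleftrightarrow> a = b" for a b
    using permutes_inj[OF p] by (auto dest: injD)
  have cc: "members_upto ?A (i - 1) = members_upto ?B (p i - 1)" "p i = Suc (level r ?A (i - 1))"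
    using center_gap_zero[OF p c r] by (simp_all add: gap_def)
  have bd: "i - 1 \<le> members_upto ?A (i - 1) + r" "i \<le> members_upto ?A i + r"
    using members_upto_complement_le[OF ascents_subset r] \<open>i < n\<close> by auto
  have cA: "members_upto ?A i = members_upto ?A (i - 1) + (if i \<in> ?A then 1 else 0)"
    using members_upto_Suc[of ?A "i - 1"] i by simp
  have un: "rising n p i \<union> falling n p i = {1..n}" and int: "rising n p i \<inter> falling n p i = {i}"
    using rising_Un_falling[OF inj i] rising_Int_falling[OF inj i] by auto
  have iD: "i \<in> falling n p i" and iI: "i \<in> rising n p i" using int by auto
  show ?thesis
  proof (cases "i \<in> ?A")
    case True
    have "level r ?A i = p i"
    proof -
      have "2 * Suc a + r - i = Suc (2 * a + r - (i - 1))" if "i - 1 \<le> a + r" "1 \<le> i" for a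
        using that by (cases i) (simp_all add: Suc_diff_le)
      then show ?thesis
        using cA True bd(1) cc(2) i by (simp add: level_def)
    qed
    then have "members_upto ?B (p i) = Suc (members_upto ?B (p i - 1))"
      using cross cA True cc(1) by simp
    moreover have "Suc (p i - 1) = p i" using v by simp
    ultimately have "p i \<in> ?B"
      using members_upto_Suc[of ?B "p i - 1"] by (metis add_0_right n_not_Suc_n)
    \<comment> \<open>The value \<open>Suc (p i)\<close> is taken to the right of \<open>i\<close>, and the sequence through \<open>i\<close> is increasing,
      so it can be taken no later than at \<open>Suc i\<close>.\<close>
    define j where "j = inv p (Suc (p i))"
    have "p i \<in> {1..<n}" "inv p (p i) < j"
      using \<open>p i \<in> ?B\<close> unfolding ascents_def j_def by blast+
    then have "Suc (p i) \<in> {1..n}" "i < j" "p j = Suc (p i)"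
      by (simp_all add: j_def pinv)
    then have j: "j \<in> {1..n}" "i < j" "p j = Suc (p i)"
      using permutes_in_image[OF permutes_inv[OF p]] unfolding j_def by blast+
    have up: "p i < p (Suc i)" using True by (simp add: ascents_def)
    then have "Suc i \<in> rising n p i" "j \<in> rising n p i"
      using j i' by (auto simp: rising_def)
    then have "\<not> Suc i < j"
      using I up j(3) by (auto dest: monotone_onD)
    then have next_p: "p (Suc i) = Suc (p i)" using j by (metis Suc_lessI)
    have "strict_antimono_on (insert (Suc i) (falling n p i - {i})) p"
    proof (rule monotone_onI)
      fix x y assume xy: "x \<in> insert (Suc i) (falling n p i - {i})"
        "y \<in> insert (Suc i) (falling n p i - {i})" "x < y"
      consider "x = Suc i" "y \<in> falling n p i" "i < y"
        | "y = Suc i" "x \<in> falling n p i" "x < i" | "x \<in> falling n p i" "y \<in> falling n p i"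
        using xy by fastforce
      then show "p x > p y"
      proof cases
        case 1
        then show ?thesis using monotone_onD[OF D iD 1(2,3)] next_p by simp
      next
        case 2
        then have "p i < p x" using monotone_onD[OF D 2(2) iD 2(3)] by simp
        then show ?thesis using 2 xy(3) next_p eq[of x "Suc i"] by auto
      next
        case 3
        then show ?thesis using monotone_onD[OF D 3 xy(3)] by simp
      qed
    qed
    moreover have "Suc i \<notin> falling n p i"
      using int \<open>Suc i \<in> rising n p i\<close> by (metis Int_iff n_not_Suc_n singletonD)
    then have "rising n p i \<union> insert (Suc i) (falling n p i - {i}) = {1..n}"
      and "rising n p i \<inter> insert (Suc i) (falling n p i - {i}) = {Suc i}"
      using un int iI \<open>Suc i \<in> rising n p i\<close> by blast+
    ultimately show ?thesis
      by (rule center_of_cover(1)[OF I])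
  next
    case False
    have lev: "p i = Suc (Suc (level r ?A i))"
    proof -
      have "2 * a + r - (i - 1) = Suc (2 * a + r - i)" if "i \<le> a + r" "1 \<le> i" for a
        using that by (cases i) (simp_all add: Suc_diff_Suc)
      then show ?thesis
        using cA False bd(2) cc(2) i by (simp add: level_def)
    qed
    have "members_upto ?B (p i - 1) = members_upto ?B (level r ?A i)"
      using cross cA False cc(1) by simp
    moreover have lev': "p i - 1 = Suc (level r ?A i)" using lev by simp
    ultimately have "members_upto ?B (Suc (level r ?A i)) = members_upto ?B (level r ?A i)" by metis
    then have "Suc (level r ?A i) \<notin> ?B" by (auto simp: members_upto_Suc)
    then have notB: "p i - 1 \<notin> ?B" unfolding lev' .
    \<comment> \<open>Dually, the value \<open>p i - 1\<close> is taken to the right of \<open>i\<close>, hence at \<open>Suc i\<close>.\<close>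
    define j where "j = inv p (p i - 1)"
    have pj: "p i = Suc (p j)"
      using lev by (simp add: j_def pinv)
    then have "j \<noteq> i" by (metis n_not_Suc_n)
    have "p j \<in> {1..n}" "p j < n" using lev pj v by simp_all
    then have j: "j \<in> {1..n}" using permutes_in_image[OF p] by blast
    have "\<not> j < i"
    proof
      assume "j < i"
      moreover have "inv p (Suc (p j)) = i" "inv p (p j) = j"
        by (simp_all add: pj[symmetric] pinv)
      ultimately have "p j \<in> ?B"
        using \<open>p j \<in> {1..n}\<close> \<open>p j < n\<close> by (simp add: ascents_def)
      then show False using notB pj by simp
    qed
    then have "i < j" using \<open>j \<noteq> i\<close> by simp
    have down: "p (Suc i) < p i"
      using False i \<open>i < n\<close> eq[of i "Suc i"] by (auto simp: ascents_def)
    then have "Suc i \<in> falling n p i" "j \<in> falling n p i"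
      using j i' pj \<open>i < j\<close> by (auto simp: falling_def)
    then have "\<not> Suc i < j"
      using D down pj by (auto dest: monotone_onD)
    then have next_p: "p i = Suc (p (Suc i))" using pj \<open>i < j\<close> by (metis Suc_lessI)
    have "strict_mono_on (insert (Suc i) (rising n p i - {i})) p"
    proof (rule monotone_onI)
      fix x y assume xy: "x \<in> insert (Suc i) (rising n p i - {i})"
        "y \<in> insert (Suc i) (rising n p i - {i})" "x < y"
      consider "x = Suc i" "y \<in> rising n p i" "i < y"
        | "y = Suc i" "x \<in> rising n p i" "x < i" | "x \<in> rising n p i" "y \<in> rising n p i"
        using xy by fastforce
      then show "p x < p y"
      proof cases
        case 1
        then show ?thesis using monotone_onD[OF I iI 1(2,3)] next_p by simp
      next
        case 2
        then have "p x < p i" using monotone_onD[OF I 2(2) iI 2(3)] by simp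
        then show ?thesis using 2 xy(3) next_p eq[of x "Suc i"] by auto
      next
        case 3
        then show ?thesis using monotone_onD[OF I 3 xy(3)] by simp
      qed
    qed
    moreover have "Suc i \<notin> rising n p i"
      using int \<open>Suc i \<in> falling n p i\<close> by (metis Int_iff n_not_Suc_n singletonD)
    then have "insert (Suc i) (rising n p i - {i}) \<union> falling n p i = {1..n}"
      and "insert (Suc i) (rising n p i - {i}) \<inter> falling n p i = {Suc i}"
      using un int iD \<open>Suc i \<in> falling n p i\<close> by blast+
    ultimately show ?thesis
      by (rule center_of_cover(1)[OF _ D])
  qed
qed

text \<open>Because the distance is monotone, the paths stay together between two common points, and the
  centre can be moved along.\<close>

lemma center_at_gap_zero:
  assumes p: "p permutes {1..n}" and c: "center n p i" and r: "card (ascents n p) + r + 1 = n"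
    and "i \<le> j" "j \<le> n" and gap: "gap r (ascents n p) (ascents n (inv p)) (j - 1) = 0"
  shows "center n p j"
proof -
  let ?h = "gap r (ascents n p) (ascents n (inv p))"
  have i: "1 \<le> i" using c by (simp add: center_def)
  have h0: "?h (i - 1) = 0"
    using center_gap_zero(1)[OF p c r] .
  have "m \<le> j \<Longrightarrow> center n p m" if "i \<le> m" for m
    using that
  proof (induction m rule: dec_induct)
    case base
    show ?case by (rule c)
  next
    case (step m)
    have "i - 1 \<le> m" "m \<le> j - 1" "j - 1 < n" "m < n"
      using step i \<open>j \<le> n\<close> by auto
    then have "?h m = 0"
      using gap_mono[OF ascents_subset r, of "i - 1" m] gap_mono[OF ascents_subset r, of m "j - 1"]
        h0 gap by (metis order_antisym)
    then show ?case
      using step \<open>m < n\<close> by (intro center_step[OF p _ r]) simp_all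
  qed
  then show ?thesis using \<open>i \<le> j\<close> by blast
qed

section \<open>The bijection and the closed formula\<close>

text \<open>The centre of the permutation whose centre comes first moves to the centre of the other one, as
  both are common points of the same two paths; its value is determined by the paths too.\<close>

lemma ascents_inject:
  assumes p: "p permutes {1..n}" and q: "q permutes {1..n}"
    and c: "center n p i" "center n q j"
    and asc: "ascents n p = ascents n q" "ascents n (inv p) = ascents n (inv q)"
  shows "p = q"
  using assms
proof (induction i j arbitrary: p q rule: linorder_wlog)
  case (le i j)
  have "inj_on p {1..n}" using le.prems(1) by (rule permutes_inj_on)
  then have "card (ascents n p) < n"
    using card_mono[OF _ ascents_subset[of n p]] le.prems(3) by (auto simp: center_def)
  then obtain r where r: "card (ascents n p) + r + 1 = n"
    by (metis add.commute less_natE add_Suc_right Suc_eq_plus1)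
  have rq: "card (ascents n q) + r + 1 = n" using r le.prems(5) by simp
  note cq = center_gap_zero[OF le.prems(2,4) rq]
  have "gap r (ascents n p) (ascents n (inv p)) (j - 1) = 0"
    using cq(1) le.prems(5,6) by simp
  moreover have "j \<le> n" using le.prems(4) by (simp add: center_def)
  ultimately have cj: "center n p j"
    using center_at_gap_zero[OF le.prems(1,3) r le.hyps] by blast
  have "p j = q j"
    using cq(2) center_gap_zero(2)[OF le.prems(1) cj r] le.prems(5) by simp
  then show ?case
    using permutation_unique_of_center le.prems cj by blast
next
  case (sym i j)
  then show ?case by metis
qed

text \<open>Take a common point of the two paths as the centre, with position \<open>i\<close> and value \<open>v\<close>. It tells which
  positions and values belong to the increasing sequence \<open>f\<close> and the decreasing sequence \<open>g\<close>. That
  the paths meet means that \<open>i\<close> and \<open>v\<close> have equal rank among positions and values of either sequence,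
  so \<open>f\<close> and \<open>g\<close> both send \<open>i\<close> to \<open>v\<close> and can be merged.\<close>

lemma ex_permutation_with_ascents:
  assumes A: "A \<subseteq> {1..<n}" and B: "B \<subseteq> {1..<n}" and card: "card A = card B" and "1 \<le> n"
  shows "\<exists>p i. p permutes {1..n} \<and> center n p i \<and> ascents n p = A \<and> ascents n (inv p) = B"
proof -
  have fin: "finite A" "finite B" using A B finite_subset by blast+
  have "card A < n" using card_mono[OF _ A] \<open>1 \<le> n\<close> by simp
  then obtain r where r: "card A + r + 1 = n"
    by (metis add.commute less_natE add_Suc_right Suc_eq_plus1)
  obtain t where t: "t < n" "members_upto A t = members_upto B (level r A t)"
    using ex_gap_zero[OF A r B] card by (auto simp: gap_def)
  define i v where "i = Suc t" and "v = Suc (level r A t)"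
  have bd: "t \<le> members_upto A t + r" using members_upto_complement_le[OF A r t(1)] .
  have i: "i \<in> {1..n}" using t by (simp add: i_def)
  have v: "v \<in> {1..n}"
    using members_upto_le_card[OF fin(1), of t] members_upto_le[of A t] r by (simp add: v_def level_def)
  define I V where "I = insert_gap i A" and "V = insert_gap v B"
  define D W where "D = insert i ({1..n} - I)" and "W = insert v ({1..n} - V)"
  have sub: "I \<subseteq> {1..n}" "V \<subseteq> {1..n}"
    using insert_gap_subset A B i v by (simp_all add: I_def V_def)
  have mem: "i \<in> I" "v \<in> V" "i \<in> D" "v \<in> W"
    by (simp_all add: I_def V_def D_def W_def insert_gap_def)
  have fin': "finite I" "finite V" "finite D" "finite W"
    using sub finite_subset by (auto simp: D_def W_def)
  have cI: "card I = Suc (card A)" "card V = Suc (card A)"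
    using fin card by (simp_all add: I_def V_def card_insert_gap)
  have cD: "card D = Suc r" "card W = Suc r"
    using mem sub fin' cI r by (simp_all add: D_def W_def card_insert_disjoint card_Diff_subset)
  have rI: "card {j\<in>I. j < i} = members_upto A t" "card {w\<in>V. w < v} = members_upto A t"
    using card_less_eq_members_upto[OF A, of i] card_less_eq_members_upto[OF B, of v] t(2)
    by (simp_all add: I_def V_def insert_gap_less i_def v_def)
  have rD: "card {j\<in>D. j < i} + members_upto A t = t" "card {w\<in>W. w < v} + members_upto A t = level r A t"
    using card_complement_less[OF i mem(1) sub(1)] card_complement_less[OF v mem(2) sub(2)] rI
    by (simp_all add: D_def W_def i_def v_def)
  obtain f where f: "strict_mono_on I f" "f ` I = V"
    using ex_strict_mono_on fin' cI by metis
  obtain g where g: "strict_antimono_on D g" "g ` D = W"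
    using ex_strict_antimono_on fin' cD by metis
  have fi: "f i = v"
  proof (rule rank_inject[OF fin'(2) _ mem(2)])
    show "f i \<in> V" using f(2) mem(1) by blast
    have "card {w\<in>V. w < f i} = members_upto A t"
      using rank_strict_mono_on[OF f(1) mem(1)] unfolding f(2) rI .
    then show "card {w\<in>V. w < f i} = card {w\<in>V. w < v}"
      by (simp only: rI)
  qed
  have gi: "g i = v"
  proof (rule rank_inject[OF fin'(4) _ mem(4)])
    show "g i \<in> W" using g(2) mem(3) by blast
    have "card {w\<in>W. w < g i} = card {j\<in>D. i < j}"
      using rank_strict_antimono_on[OF g(1) mem(3)] unfolding g(2) .
    moreover have "level r A t + t = 2 * members_upto A t + r"
      using bd by (simp add: level_def)
    ultimately show "card {w\<in>W. w < g i} = card {w\<in>W. w < v}"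
      using card_less_greater[OF fin'(3) mem(3)] rD cD by linarith
  qed
  define p where "p j = (if j \<in> I then f j else if j \<in> {1..n} then g j else j)" for j
  have pI: "p j = f j" if "j \<in> I" for j using that by (simp add: p_def)
  have pD: "p j = g j" if "j \<in> D" for j
    using that fi gi mem(1) by (auto simp: p_def D_def)
  have img: "p ` I = V" "p ` D = W"
    using f(2) g(2) pI pD by (simp_all cong: image_cong)
  have un: "I \<union> D = {1..n}" "V \<union> W = {1..n}" and int: "I \<inter> D = {i}"
    using sub mem i v by (auto simp: D_def W_def)
  have pn: "p ` {1..n} = {1..n}"
    using img un by (metis image_Un)
  have p: "p permutes {1..n}"
  proof (rule bij_imp_permutes)
    show "bij_betw p {1..n} {1..n}"
      using pn by (simp add: bij_betw_def eq_card_imp_inj_on)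
    show "p x = x" if "x \<notin> {1..n}" for x
      using that sub(1) by (auto simp: p_def)
  qed
  have mI: "strict_mono_on I p" and mD: "strict_antimono_on D p"
    using f(1) g(1) pI pD by (simp_all add: monotone_on_def)
  note c = center_of_cover[OF mI mD un(1) int]
  have inj: "inj_on p {1..n}" "inj_on (inv p) {1..n}"
    using p permutes_inv[of _ "{1..n}"] by (auto intro: permutes_inj_on)
  have "insert_gap i (ascents n p) = insert_gap i A"
    using rising_eq_insert_gap[OF inj(1) c(1)] c(2) by (simp add: I_def)
  moreover have "insert_gap v (ascents n (inv p)) = insert_gap v B"
    using rising_eq_insert_gap[OF inj(2) center_inv(1)[OF p c(1)]] center_inv(2)[OF p c(1)]
      c(2) img(1) pI[OF mem(1)] fi by (simp add: V_def)
  ultimately show ?thesis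
    using p c(1) by (auto simp: insert_gap_inject)
qed

lemma m_count_eq:
  assumes k: "k \<in> {1..n}"
  shows "m_count n k = (n - 1 choose (k - 1))\<^sup>2"
proof -
  let ?H = "{p. p permutes {1..n} \<and> longest_inc n p = k \<and> longest_dec n p = n - k + 1}"
  let ?X = "{A. A \<subseteq> {1..<n} \<and> card A = k - 1}"
  have H: "p \<in> ?H \<longleftrightarrow> p permutes {1..n} \<and> (\<exists>i. center n p i \<and> card (ascents n p) = k - 1)" for p
  proof (cases "p permutes {1..n}")
    case True
    then have inj: "inj_on p {1..n}" by (rule permutes_inj_on)
    have "card (rising n p i) = k \<longleftrightarrow> card (ascents n p) = k - 1" if "center n p i" for i
      using card_rising[OF inj that] k by auto
    then show ?thesis using True longest_iff_center[OF inj k] by auto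
  qed simp
  have inv: "card (ascents n (inv p)) = card (ascents n p)"
    if p: "p permutes {1..n}" and c: "center n p i" for p i
  proof -
    have "inj_on p {1..n}" "inj_on (inv p) {1..n}"
      using p permutes_inv[of _ "{1..n}"] by (auto intro: permutes_inj_on)
    moreover have "card (p ` rising n p i) = card (rising n p i)"
      using permutes_inj_on[OF p] by (rule card_image)
    ultimately show ?thesis
      using card_rising center_inv[OF p c] c by (metis Suc_inject)
  qed
  have "bij_betw (\<lambda>p. (ascents n p, ascents n (inv p))) ?H (?X \<times> ?X)"
    unfolding bij_betw_def
  proof (intro conjI inj_onI set_eqI iffI)
    fix p q assume "p \<in> ?H" "q \<in> ?H"
      "(ascents n p, ascents n (inv p)) = (ascents n q, ascents n (inv q))"
    then show "p = q" unfolding H using ascents_inject by blast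
  next
    fix x assume "x \<in> (\<lambda>p. (ascents n p, ascents n (inv p))) ` ?H"
    then obtain p where "p \<in> ?H" "x = (ascents n p, ascents n (inv p))" by blast
    then show "x \<in> ?X \<times> ?X"
      unfolding H using inv ascents_subset by auto
  next
    fix x assume "x \<in> ?X \<times> ?X"
    then obtain A B where x: "x = (A, B)" "A \<subseteq> {1..<n}" "B \<subseteq> {1..<n}" "card A = k - 1" "card B = k - 1"
      by auto
    then obtain p i where "p permutes {1..n}" "center n p i" "ascents n p = A" "ascents n (inv p) = B"
      using ex_permutation_with_ascents[of A n B] k by auto
    then show "x \<in> (\<lambda>p. (ascents n p, ascents n (inv p))) ` ?H"
      using x(1,4) H[of p] by (intro image_eqI[of _ _ p]) auto
  qed
  then have "card ?H = card (?X \<times> ?X)" by (rule bij_betw_same_card)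
  then show ?thesis
    unfolding m_count_def by (simp add: card_cartesian_product n_subsets power2_eq_square)
qed

section \<open>Log-concavity\<close>

text \<open>The ratio of consecutive binomial coefficients, \<open>(m - j) / (j + 1)\<close>, decreases with \<open>j\<close>; the two
  equations in the proof state it without division.\<close>

lemma binomial_log_concave:
  "(m choose j) * (m choose (j + 2)) \<le> (m choose (j + 1))\<^sup>2"
proof (cases "j + 2 \<le> m")
  case True
  define a b c where "a = m choose j" and "b = m choose (j + 1)" and "c = m choose (j + 2)"
  have ab: "(j + 1) * b = (m - j) * a" and bc: "(j + 2) * c = (m - (j + 1)) * b"
    using binomial_absorb_comp[of m j] binomial_absorb_comp[of m "j + 1"]
      binomial_absorption[of j m] binomial_absorption[of "j + 1" m]
    by (simp_all add: a_def b_def c_def)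
  have "((m - j) * (j + 2)) * (a * c) = ((m - j) * a) * ((j + 2) * c)"
    by (simp only: ac_simps)
  also have "\<dots> = ((j + 1) * b) * ((m - (j + 1)) * b)"
    by (simp only: ab bc)
  also have "\<dots> = ((j + 1) * (m - (j + 1))) * b\<^sup>2"
    by (simp only: power2_eq_square mult.assoc mult.left_commute mult.commute)
  also have "\<dots> \<le> ((m - j) * (j + 2)) * b\<^sup>2"
    by (subst mult.commute[of "m - j"]) (intro mult_right_mono mult_mono; simp)
  finally have "a * c \<le> b\<^sup>2"
    using True by simp
  then show ?thesis by (simp add: a_def b_def c_def)
qed (simp add: binomial_eq_0)

theorem corollary3p3:
  fixes n :: nat
  assumes "n \<ge> 1"
  shows "log_concave_seq 1 n (\<lambda>k. real (m_count n k))"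
  unfolding log_concave_seq_def
proof (intro conjI ballI)
  fix k assume k: "k \<in> {1..n}"
  then have "k - 1 \<le> n - 1" by auto
  then show "0 < real (m_count n k)"
    by (simp add: m_count_eq[OF k])
next
  fix k assume k: "k \<in> {1<..<n}"
  then obtain j where j: "k = j + 2"
    using le_Suc_ex[of 2 k] by (auto simp: add.commute)
  have "m_count n (k - 1) * m_count n (k + 1)
      = ((n - 1 choose j) * (n - 1 choose (j + 2)))\<^sup>2"
    using k j by (simp add: m_count_eq power_mult_distrib)
  also have "\<dots> \<le> ((n - 1 choose (j + 1))\<^sup>2)\<^sup>2"
    using binomial_log_concave by (rule power_mono) simp
  also have "\<dots> = (m_count n k)\<^sup>2"
    using k j by (simp add: m_count_eq)
  finally show "real (m_count n (k - 1)) * real (m_count n (k + 1)) \<le> (real (m_count n k))\<^sup>2"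
    by (metis of_nat_le_iff of_nat_mult of_nat_power)
qed

end
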